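(* Let $2\leq n\leq\infty$. The isomorphism relation on countable tournaments is Borel reducible to the conjugacy relation on $\mathrm{Aut}(n*I_\infty)$. Hence the conjugacy relation on $\mathrm{Aut}(n*I_\infty)$ is Borel complete.
   Context: A digraph is a set with an irreflexive antisymmetric relation $\to$; a tournament is a digraph in which any two distinct vertices are joined by an edge. A digraph is complete $n$-partite if its vertex set is partitioned into $n$ independent sets (parts) and any two vertices in distinct parts are joined by an edge (in one direction). $n*I_\infty$ denotes the generic countable complete $n$-partite digraph: the countable homogeneous complete $n$-partite digraph (with infinite parts) whose finite substructures are all finite complete $n$-partite digraphs. Conjugacy on $\mathrm{Aut}(n*I_\infty)$ identifies $\phi,\psi$ iff $\psi=\delta\phi\delta^{-1}$ for some automorphism $\delta$. $E\leq_B F$ means there is a Borel $f$ with $x\mathrel{E}x'\iff f(x)\mathrel{F}f(x')$; $E$ is Borel complete if isomorphism on every Borel class of countable structures in a countable relational language Borel reduces to $E$. *)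

theory Defs
  imports "HOL-Analysis.Analysis" "HOL-Library.Disjoint_Sets" "HOL-Library.Extended_Nat"
begin

definition digraph :: "'a set \<Rightarrow> ('a \<Rightarrow> 'a \<Rightarrow> bool) \<Rightarrow> bool" where
  "digraph V E \<longleftrightarrow>
     (\<forall>x y. E x y \<longrightarrow> x \<in> V \<and> y \<in> V) \<and> irreflp_on V E \<and> antisymp_on V E"

definition tournament :: "'a set \<Rightarrow> ('a \<Rightarrow> 'a \<Rightarrow> bool) \<Rightarrow> bool" where
  "tournament V E \<longleftrightarrow> digraph V E \<and> totalp_on V E"

text \<open>Only the restrictions of \<open>E\<close> to \<open>V\<close> and of \<open>E'\<close> to \<open>V'\<close> matter here, so that the
  notion also applies to induced subdigraphs.\<close>

definition digraph_iso ::
    "'a set \<Rightarrow> ('a \<Rightarrow> 'a \<Rightarrow> bool) \<Rightarrow> 'b set \<Rightarrow> ('b \<Rightarrow> 'b \<Rightarrow> bool) \<Rightarrow> ('a \<Rightarrow> 'b) \<Rightarrow> bool" where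
  "digraph_iso V E V' E' h \<longleftrightarrow>
     bij_betw h V V' \<and> (\<forall>x\<in>V. \<forall>y\<in>V. E x y \<longleftrightarrow> E' (h x) (h y))"

definition Aut :: "('a \<Rightarrow> 'a \<Rightarrow> bool) \<Rightarrow> ('a \<Rightarrow> 'a) set" where
  "Aut E = {\<phi>. digraph_iso UNIV E UNIV E \<phi>}"

definition homogeneous :: "('a \<Rightarrow> 'a \<Rightarrow> bool) \<Rightarrow> bool" where
  "homogeneous E \<longleftrightarrow>
     (\<forall>A B h. finite A \<longrightarrow> digraph_iso A E B E h \<longrightarrow> (\<exists>\<phi>\<in>Aut E. \<forall>x\<in>A. \<phi> x = h x))"

definition ecard :: "'a set \<Rightarrow> enat" where
  "ecard A = (if finite A then enat (card A) else \<infinity>)"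

text \<open>\<open>P\<close> is the set of parts; \<open>partition_on\<close> requires the parts to be nonempty.\<close>

definition multipartite_with :: "'a set set \<Rightarrow> 'a set \<Rightarrow> ('a \<Rightarrow> 'a \<Rightarrow> bool) \<Rightarrow> bool" where
  "multipartite_with P V E \<longleftrightarrow>
     digraph V E \<and> partition_on V P \<and>
     (\<forall>p\<in>P. \<forall>x\<in>p. \<forall>y\<in>p. \<not> E x y) \<and>
     (\<forall>p\<in>P. \<forall>q\<in>P. p \<noteq> q \<longrightarrow> (\<forall>x\<in>p. \<forall>y\<in>q. E x y \<or> E y x))"

definition complete_multipartite :: "enat \<Rightarrow> 'a set \<Rightarrow> ('a \<Rightarrow> 'a \<Rightarrow> bool) \<Rightarrow> bool" where
  "complete_multipartite n V E \<longleftrightarrow> (\<exists>P. ecard P = n \<and> multipartite_with P V E)"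

text \<open>\<open>E\<close> is a copy of \<open>n * I\<^sub>\<infinity>\<close> with vertex set the natural numbers. A substructure of
  a complete \<open>n\<close>-partite digraph may miss some of the parts, so its number of
  (nonempty) parts is some \<open>m \<le> n\<close>. Finite digraphs on sets of natural numbers represent
  all finite digraphs up to isomorphism.\<close>

definition generic_multipartite :: "enat \<Rightarrow> (nat \<Rightarrow> nat \<Rightarrow> bool) \<Rightarrow> bool" where
  "generic_multipartite n E \<longleftrightarrow>
     (\<exists>P. ecard P = n \<and> (\<forall>p\<in>P. infinite p) \<and> multipartite_with P UNIV E) \<and>
     homogeneous E \<and>
     (\<forall>(W :: nat set) F. finite W \<longrightarrow> digraph W F \<longrightarrow>
        ((\<exists>B h. digraph_iso W F B E h) \<longleftrightarrow> (\<exists>m\<le>n. complete_multipartite m W F)))"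

definition conjugacy :: "('a \<Rightarrow> 'a \<Rightarrow> bool) \<Rightarrow> ('a \<Rightarrow> 'a) rel" where
  "conjugacy E = {(\<phi>, \<psi>). \<phi> \<in> Aut E \<and> \<psi> \<in> Aut E \<and> (\<exists>\<delta>\<in>Aut E. \<psi> = \<delta> \<circ> \<phi> \<circ> inv \<delta>)}"

text \<open>A countable structure (finite or infinite) is coded by the characteristic functions of
  its universe, a set of natural numbers, and of its relations. Since \<open>bool\<close> is discrete, the
  product topology on the type of codes is that of the Cantor space.\<close>

definition countable_tournaments :: "((nat \<Rightarrow> bool) \<times> (nat \<Rightarrow> nat \<Rightarrow> bool)) set" where
  "countable_tournaments = {(U, E). tournament (Collect U) E}"

definition tournament_isomorphism :: "((nat \<Rightarrow> bool) \<times> (nat \<Rightarrow> nat \<Rightarrow> bool)) rel" where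
  "tournament_isomorphism =
     {((U, E), (U', E')). (U, E) \<in> countable_tournaments \<and> (U', E') \<in> countable_tournaments \<and>
        (\<exists>h. digraph_iso (Collect U) E (Collect U') E' h)}"

text \<open>A countable relational language is given by its set \<open>L\<close> of relation symbols, without
  loss of generality natural numbers, and their arities \<open>ar\<close>. The symbol \<open>i\<close> is interpreted
  by the relation \<open>R i\<close> on tuples; requiring that \<open>R\<close> vanish off such tuples makes codes unique.\<close>

type_synonym code = "(nat \<Rightarrow> bool) \<times> (nat \<Rightarrow> nat list \<Rightarrow> bool)"

definition structures :: "nat set \<Rightarrow> (nat \<Rightarrow> nat) \<Rightarrow> code set" where
  "structures L ar =
     {(U, R). \<forall>i xs. R i xs \<longrightarrow> i \<in> L \<and> length xs = ar i \<and> set xs \<subseteq> Collect U}"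

definition structure_isomorphism :: "nat set \<Rightarrow> (nat \<Rightarrow> nat) \<Rightarrow> code rel" where
  "structure_isomorphism L ar =
     {((U, R), (U', R')). (U, R) \<in> structures L ar \<and> (U', R') \<in> structures L ar \<and>
        (\<exists>h. bij_betw h (Collect U) (Collect U') \<and>
          (\<forall>i\<in>L. \<forall>xs. length xs = ar i \<longrightarrow> set xs \<subseteq> Collect U \<longrightarrow>
             (R i xs \<longleftrightarrow> R' i (map h xs))))}"

definition borel_reducible ::
    "'a::topological_space set \<Rightarrow> 'a rel \<Rightarrow> 'b::topological_space set \<Rightarrow> 'b rel \<Rightarrow> bool" where
  "borel_reducible X E Y F \<longleftrightarrow>
     (\<exists>f \<in> restrict_space borel X \<rightarrow>\<^sub>M restrict_space borel Y.
        \<forall>x\<in>X. \<forall>x'\<in>X. (x, x') \<in> E \<longleftrightarrow> (f x, f x') \<in> F)"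

definition borel_complete :: "'b::topological_space set \<Rightarrow> 'b rel \<Rightarrow> bool" where
  "borel_complete Y F \<longleftrightarrow>
     (\<forall>L ar. \<forall>C\<in>sets borel. C \<subseteq> structures L ar \<longrightarrow>
        borel_reducible C (structure_isomorphism L ar) Y F)"

end

theory Submission
  imports Defs
begin

text \<open>
  To a countable structure \<open>M\<close> one attaches functorially a generic multipartite digraph \<open>D\<^sub>M\<close> with an
  automorphism \<open>\<phi>\<^sub>M\<close> from which \<open>M\<close> can be recovered. Starting from the incidence digraph of the
  elements and tuples of \<open>M\<close>, replace each node by a finite cycle of \<open>\<phi>\<^sub>M\<close> whose length is the color
  of the node, and freely add witnesses of the extension property, each in infinitely many copies
  indexed by the integers and shifted by \<open>\<phi>\<^sub>M\<close>. The finite orbits of \<open>\<phi>\<^sub>M\<close> then are exactly the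
  nodes, and their lengths tell elements from tuples and the relation symbols apart. A
  back-and-forth construction, which is Borel in \<open>M\<close>, identifies \<open>D\<^sub>M\<close> with the given digraph and
  turns \<open>\<phi>\<^sub>M\<close> into an automorphism of it. Tournaments are the special case of one binary relation.
\<close>

section \<open>Borel back-and-forth\<close>

text \<open>Parts are numbered by \<open>p\<close> instead of being given as a partition, so that
  partial isomorphisms can be required to preserve part numbers. The last clause is the one-point
  extension property; no arcs can be prescribed towards vertices of the part \<open>q\<close>
  itself. As \<open>z\<close> avoids \<open>F\<close>, each pattern is realized infinitely
  often.\<close>

definition extensible ::
    "enat \<Rightarrow> 'a set \<Rightarrow> ('a \<Rightarrow> nat) \<Rightarrow> ('a \<Rightarrow> 'a \<Rightarrow> bool) \<Rightarrow> bool" where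
  "extensible n V p E \<longleftrightarrow>
     (\<forall>x\<in>V. enat (p x) < n) \<and>
     (\<forall>x\<in>V. \<forall>y\<in>V. p x = p y \<longrightarrow> \<not> E x y) \<and>
     (\<forall>x\<in>V. \<forall>y\<in>V. p x \<noteq> p y \<longrightarrow> (E y x \<longleftrightarrow> \<not> E x y)) \<and>
     (\<forall>F T q. finite F \<longrightarrow> F \<subseteq> V \<longrightarrow> enat q < n \<longrightarrow>
        (\<exists>z\<in>V - F. p z = q \<and> (\<forall>y\<in>F. p y \<noteq> q \<longrightarrow> (E z y \<longleftrightarrow> y \<in> T))))"

lemma
  assumes "extensible n V p E"
  shows extensible_part: "x \<in> V \<Longrightarrow> enat (p x) < n"
    and extensible_same: "x \<in> V \<Longrightarrow> y \<in> V \<Longrightarrow> p x = p y \<Longrightarrow> \<not> E x y"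
    and extensible_cross: "x \<in> V \<Longrightarrow> y \<in> V \<Longrightarrow> p x \<noteq> p y \<Longrightarrow> E y x \<longleftrightarrow> \<not> E x y"
    and extensible_ex: "finite F \<Longrightarrow> F \<subseteq> V \<Longrightarrow> enat q < n \<Longrightarrow>
      \<exists>z\<in>V - F. p z = q \<and> (\<forall>y\<in>F. p y \<noteq> q \<longrightarrow> (E z y \<longleftrightarrow> y \<in> T))"
  using assms[unfolded extensible_def, THEN conjunct1]
    assms[unfolded extensible_def, THEN conjunct2, THEN conjunct1]
    assms[unfolded extensible_def, THEN conjunct2, THEN conjunct2, THEN conjunct1]
    assms[unfolded extensible_def, THEN conjunct2, THEN conjunct2, THEN conjunct2]
  by (iprover | meson)+

lemma extensibleI:
  assumes "\<And>x. x \<in> V \<Longrightarrow> enat (p x) < n"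
    and "\<And>x y. x \<in> V \<Longrightarrow> y \<in> V \<Longrightarrow> p x = p y \<Longrightarrow> \<not> E x y"
    and "\<And>x y. x \<in> V \<Longrightarrow> y \<in> V \<Longrightarrow> p x \<noteq> p y \<Longrightarrow> E y x \<longleftrightarrow> \<not> E x y"
    and "\<And>F T q. finite F \<Longrightarrow> F \<subseteq> V \<Longrightarrow> enat q < n \<Longrightarrow>
      \<exists>z\<in>V - F. p z = q \<and> (\<forall>y\<in>F. p y \<noteq> q \<longrightarrow> (E z y \<longleftrightarrow> y \<in> T))"
  shows "extensible n V p E"
  unfolding extensible_def
  by (intro conjI ballI allI impI) (rule assms; assumption)+

section \<open>Finite partial isomorphisms and their one-point extensions\<close>

definition partial_iso ::
    "'a set \<Rightarrow> ('a \<Rightarrow> nat) \<Rightarrow> ('a \<Rightarrow> 'a \<Rightarrow> bool) \<Rightarrow> 'b set \<Rightarrow> ('b \<Rightarrow> nat) \<Rightarrow> ('b \<Rightarrow> 'b \<Rightarrow> bool)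
      \<Rightarrow> ('a \<times> 'b) set \<Rightarrow> bool" where
  "partial_iso V p E V' p' E' r \<longleftrightarrow>
     (\<forall>a b. (a, b) \<in> r \<longrightarrow> a \<in> V \<and> b \<in> V' \<and> p a = p' b) \<and>
     (\<forall>a b a' b'. (a, b) \<in> r \<longrightarrow> (a', b') \<in> r \<longrightarrow>
        (a = a' \<longleftrightarrow> b = b') \<and> (E a a' \<longleftrightarrow> E' b b'))"

lemma partial_isoD:
  assumes "partial_iso V p E V' p' E' r" "(a, b) \<in> r"
  shows "a \<in> V" "b \<in> V'" "p a = p' b"
    "\<And>a' b'. (a', b') \<in> r \<Longrightarrow> (a = a' \<longleftrightarrow> b = b') \<and> (E a a' \<longleftrightarrow> E' b b')"
  using assms unfolding partial_iso_def by simp_all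

lemma partial_isoI:
  assumes "\<And>a b. (a, b) \<in> r \<Longrightarrow> a \<in> V \<and> b \<in> V' \<and> p a = p' b"
    and "\<And>a b a' b'. (a, b) \<in> r \<Longrightarrow> (a', b') \<in> r \<Longrightarrow>
      (a = a' \<longleftrightarrow> b = b') \<and> (E a a' \<longleftrightarrow> E' b b')"
  shows "partial_iso V p E V' p' E' r"
  using assms unfolding partial_iso_def by simp

lemma partial_iso_converse:
  assumes "partial_iso V p E V' p' E' r"
  shows "partial_iso V' p' E' V p E (r\<inverse>)"
  by (rule partial_isoI; elim converseE; simp) (simp_all add: partial_isoD[OF assms])

lemma partial_iso_forth:
  assumes V: "extensible n V p E" and V': "extensible n V' p' E'"
    and r: "partial_iso V p E V' p' E' r" "finite r" and a: "a \<in> V"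
  shows "\<exists>b. partial_iso V p E V' p' E' (insert (a, b) r)"
proof (cases "a \<in> fst ` r")
  case True
  then obtain b where "(a, b) \<in> r" by force
  then show ?thesis using r(1) by (metis insert_absorb)
next
  case False
  \<comment> \<open>The pattern of arcs from \<open>a\<close> to the domain of \<open>r\<close>,
    copied along \<open>r\<close> to its range; \<open>z\<close> is to realize it in the part with
    the same number.\<close>
  define T where "T = {b. \<exists>a'. (a', b) \<in> r \<and> E a a'}"
  have F: "finite (snd ` r)" "snd ` r \<subseteq> V'"
    using r(2) partial_isoD(2)[OF r(1)] by auto
  obtain z where "z \<in> V' - snd ` r" and pz: "p' z = p a"
    and zT: "\<forall>y\<in>snd ` r. p' y \<noteq> p a \<longrightarrow> (E' z y \<longleftrightarrow> y \<in> T)"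
    using extensible_ex[OF V' F extensible_part[OF V a], of T] by (elim bexE conjE)
  then have z: "z \<in> V'" "z \<notin> snd ` r" "p' z = p a" by simp_all
  \<comment> \<open>Within a common part there are no arcs on either side; across parts the arc in
    one direction determines the other.\<close>
  have zE: "(E a a' \<longleftrightarrow> E' z b') \<and> (E a' a \<longleftrightarrow> E' b' z)" if ab: "(a', b') \<in> r" for a' b'
  proof (cases "p a' = p a")
    case True
    note d = partial_isoD[OF r(1) ab]
    show ?thesis
      using extensible_same[OF V a d(1)] extensible_same[OF V d(1) a]
        extensible_same[OF V' z(1) d(2)] extensible_same[OF V' d(2) z(1)] True d(3) z(3)
      by simp
  next
    case False
    note d = partial_isoD[OF r(1) ab]
    have b': "b' \<in> snd ` r" using ab by (metis image_eqI snd_conv)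
    have "E a a'" if "b' \<in> T"
    proof -
      obtain c where "(c, b') \<in> r" "E a c" using \<open>b' \<in> T\<close> unfolding T_def by blast
      then show ?thesis using d(4)[of c b'] by simp
    qed
    then have "b' \<in> T \<longleftrightarrow> E a a'" using ab unfolding T_def by blast
    then show ?thesis
      using bspec[OF zT b'] extensible_cross[OF V a d(1)] extensible_cross[OF V' z(1) d(2)]
        False d(3) z(3)
      by simp
  qed
  have irr: "\<not> E a a" "\<not> E' z z"
    using extensible_same[OF V a a] extensible_same[OF V' z(1) z(1)] by simp_all
  have notin: "x \<noteq> a" "y \<noteq> z" if "(x, y) \<in> r" for x y
    using that False z(2) by (metis image_eqI fst_conv, metis image_eqI snd_conv)
  have "partial_iso V p E V' p' E' (insert (a, z) r)"
  proof (rule partial_isoI)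
    fix x y assume "(x, y) \<in> insert (a, z) r"
    then consider (new) "x = a" "y = z" | (old) "(x, y) \<in> r" by blast
    note xy = this
    then show "x \<in> V \<and> y \<in> V' \<and> p x = p' y"
    proof cases
      case old
      then show ?thesis using partial_isoD[OF r(1) old] by simp
    qed (use a z in simp)
    fix x' y' assume "(x', y') \<in> insert (a, z) r"
    then consider (new') "x' = a" "y' = z" | (old') "(x', y') \<in> r" by blast
    then show "(x = x' \<longleftrightarrow> y = y') \<and> (E x x' \<longleftrightarrow> E' y y')"
    proof cases
      case new'
      from xy show ?thesis
      proof cases
        case old
        then show ?thesis using new' zE[OF old] notin[OF old] by simp
      qed (use new' irr in simp)
    next
      case old'
      from xy show ?thesis
      proof cases
        case new
        then show ?thesis using zE[OF old'] notin[OF old'] by auto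
      next
        case old
        then show ?thesis using partial_isoD(4)[OF r(1) old old'] by simp
      qed
    qed
  qed
  then show ?thesis ..
qed

lemma converse_insert_pair: "(insert (b, a) r)\<inverse> = insert (a, b) (r\<inverse>)"
  by auto

text \<open>The forth step for the converse: partial isomorphisms are relations, which makes the two
  sides symmetric.\<close>

lemma partial_iso_back:
  assumes V: "extensible n V p E" and V': "extensible n V' p' E'"
    and r: "partial_iso V p E V' p' E' r" "finite r" and b: "b \<in> V'"
  shows "\<exists>a. partial_iso V p E V' p' E' (insert (a, b) r)"
proof -
  obtain a where "partial_iso V' p' E' V p E (insert (b, a) (r\<inverse>))"
    using partial_iso_forth[OF V' V partial_iso_converse[OF r(1)] _ b] r(2) by auto
  from partial_iso_converse[OF this] have "partial_iso V p E V' p' E' (insert (a, b) r)"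
    by (metis converse_converse converse_insert_pair)
  then show ?thesis ..
qed

text \<open>At step \<open>s\<close>, the request \<open>from_nat s\<close> is served by the first pair (in the enumeration of the
  countable type of pairs) whose addition preserves \<open>Q\<close>, if there is one; choosing the first one is
  what makes the construction measurable in \<open>Q\<close>.\<close>

primrec serves :: "('a \<times> 'b) \<Rightarrow> 'a + 'b \<Rightarrow> bool" where
  "serves e (Inl a) \<longleftrightarrow> fst e = a"
| "serves e (Inr b) \<longleftrightarrow> snd e = b"

definition candidate ::
    "(('a::countable \<times> 'b::countable) set \<Rightarrow> bool) \<Rightarrow> nat \<Rightarrow> ('a \<times> 'b) list \<Rightarrow> nat \<Rightarrow> bool" where
  "candidate Q s l k \<longleftrightarrow>
     (\<exists>e. k = to_nat e \<and> Q (insert e (set l)) \<and> serves e (from_nat s))"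

text \<open>Stages are lists rather than sets so that they range over a countable type: a statement
  about a stage is then a countable disjunction over its possible values.\<close>

primrec stage :: "(('a::countable \<times> 'b::countable) set \<Rightarrow> bool) \<Rightarrow> nat \<Rightarrow> ('a \<times> 'b) list" where
  "stage Q 0 = []"
| "stage Q (Suc s) =
    (if \<exists>k. candidate Q s (stage Q s) k
     then from_nat (LEAST k. candidate Q s (stage Q s) k) # stage Q s else stage Q s)"

lemma stage_Suc_cases:
  obtains (step) e where "Q (insert e (set (stage Q s)))" "serves e (from_nat s)"
      "stage Q (Suc s) = e # stage Q s"
    | (stay) "\<And>e. Q (insert e (set (stage Q s))) \<Longrightarrow> \<not> serves e (from_nat s)"
      "stage Q (Suc s) = stage Q s"
proof (cases "\<exists>k. candidate Q s (stage Q s) k")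
  case True
  then have "candidate Q s (stage Q s) (LEAST k. candidate Q s (stage Q s) k)"
    by (rule LeastI_ex)
  then obtain e where "(LEAST k. candidate Q s (stage Q s) k) = to_nat e"
    "Q (insert e (set (stage Q s)))" "serves e (from_nat s)"
    unfolding candidate_def by blast
  then show ?thesis using step True by simp
next
  case False
  show ?thesis
  proof (rule stay)
    show "\<not> serves e (from_nat s)" if "Q (insert e (set (stage Q s)))" for e
      using that False unfolding candidate_def by blast
  qed (use False in simp)
qed

lemma stage_mono: "s \<le> t \<Longrightarrow> set (stage Q s) \<subseteq> set (stage Q t)"
proof (induction t rule: dec_induct)
  case (step t)
  then show ?case by (cases rule: stage_Suc_cases[of Q t]) auto
qed auto

lemma stage_invariant: "Q {} \<Longrightarrow> Q (set (stage Q s))"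
proof (induction s)
  case (Suc s)
  then show ?case by (cases rule: stage_Suc_cases[of Q s]) auto
qed auto

text \<open>Induction on \<open>s\<close>. Splitting over the countably many values
  \<open>l0\<close> of the previous stage and spelling out \<open>LEAST\<close> as "a candidate with
  no smaller candidate" leaves a countable Boolean combination of conditions
  \<open>Q m (set l)\<close>.\<close>

lemma measurable_stage:
  fixes Q :: "'m \<Rightarrow> ('a::countable \<times> 'b::countable) set \<Rightarrow> bool"
  assumes Q[measurable]: "\<And>l. Measurable.pred N (\<lambda>m. Q m (set l))"
  shows "Measurable.pred N (\<lambda>m. stage (Q m) s = l)"
proof (induction s arbitrary: l)
  case (Suc s)
  note Suc[measurable]
  have [measurable]: "Measurable.pred N (\<lambda>m. Q m (insert e (set l)))" for e l
    using Q[of "e # l"] by simp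
  have [measurable]: "Measurable.pred N (\<lambda>m. candidate (Q m) s l0 k)" for l0 k
    unfolding candidate_def by measurable
  have least: "x = (LEAST k. candidate (Q m) s l0 k) \<longleftrightarrow>
      candidate (Q m) s l0 x \<and> (\<forall>j<x. \<not> candidate (Q m) s l0 j)"
    if "\<exists>k. candidate (Q m) s l0 k" for m l0 x
    using that by (metis LeastI_ex Least_equality not_less not_less_Least)
  have eq: "stage (Q m) (Suc s) = l \<longleftrightarrow> (\<exists>l0. stage (Q m) s = l0 \<and>
      ((\<exists>k. (candidate (Q m) s l0 k \<and> (\<forall>j<k. \<not> candidate (Q m) s l0 j)) \<and>
          l = from_nat k # l0) \<or>
       ((\<forall>k. \<not> candidate (Q m) s l0 k) \<and> l = l0)))" for m
  proof (cases "\<exists>k. candidate (Q m) s (stage (Q m) s) k")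
    case True
    then have "stage (Q m) (Suc s) = l \<longleftrightarrow>
        (\<exists>k. k = (LEAST k. candidate (Q m) s (stage (Q m) s) k) \<and> l = from_nat k # stage (Q m) s)"
      by auto
    then show ?thesis unfolding least[OF True] using True by blast
  next
    case False
    then show ?thesis by auto
  qed
  show ?case unfolding eq by measurable
qed simp

definition limit_rel :: "(('a::countable \<times> 'b::countable) set \<Rightarrow> bool) \<Rightarrow> 'a \<Rightarrow> 'b \<Rightarrow> bool" where
  "limit_rel Q a b \<longleftrightarrow> (\<exists>s. (a, b) \<in> set (stage Q s))"

lemma measurable_limit_rel:
  fixes Q :: "'m \<Rightarrow> ('a::countable \<times> 'b::countable) set \<Rightarrow> bool"
  assumes "\<And>l. Measurable.pred N (\<lambda>m. Q m (set l))"
  shows "Measurable.pred N (\<lambda>m. limit_rel (Q m) a b)"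
proof -
  have [measurable]: "Measurable.pred N (\<lambda>m. stage (Q m) s = l)" for s l
    by (rule measurable_stage) (rule assms)
  have eq: "limit_rel (Q m) a b \<longleftrightarrow> (\<exists>s l. stage (Q m) s = l \<and> (a, b) \<in> set l)" for m
    unfolding limit_rel_def by simp
  show ?thesis unfolding eq by measurable
qed

text \<open>Every element of either side is requested at some stage, and an extension serving it
  then exists, so the union of the stages is the graph of an isomorphism. Describing
  \<open>g\<close> by \<open>limit_rel\<close> makes its dependence on the data measurable.\<close>

lemma back_and_forth:
  fixes V :: "'a::countable set" and V' :: "'b::countable set"
  assumes V: "extensible n V p E" and V': "extensible n V' p' E'"
  shows "\<exists>g. digraph_iso V E V' E' g \<and>
    (\<forall>a\<in>V. \<forall>b. limit_rel (partial_iso V p E V' p' E') a b \<longleftrightarrow> g a = b)"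
proof -
  let ?Q = "partial_iso V p E V' p' E'"
  let ?G = "limit_rel ?Q"
  have Q: "?Q (set (stage ?Q s))" for s
    by (rule stage_invariant) (simp add: partial_iso_def)
  \<comment> \<open>Some pair could serve the request, so the stage cannot stay unchanged; the pair
    actually added may be another one.\<close>
  have served: "\<exists>e. serves e (from_nat s) \<and> ?G (fst e) (snd e)"
    if "?Q (insert e (set (stage ?Q s)))" "serves e (from_nat s)" for e s
  proof (cases rule: stage_Suc_cases[of ?Q s])
    case (step e')
    then have "e' \<in> set (stage ?Q (Suc s))" by simp
    then show ?thesis using step(2) unfolding limit_rel_def by (metis prod.collapse)
  next
    case stay
    then show ?thesis using that by blast
  qed
  have dom: "\<exists>b. ?G a b" if a: "a \<in> V" for a
  proof -
    obtain s where s: "from_nat s = (Inl a :: 'a + 'b)" by (metis from_nat_to_nat)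
    obtain b where "?Q (insert (a, b) (set (stage ?Q s)))"
      using partial_iso_forth[OF V V' Q _ a] by blast
    then show ?thesis using served[of "(a, b)" s] s by auto
  qed
  have ran: "\<exists>a. ?G a b" if b: "b \<in> V'" for b
  proof -
    obtain s where s: "from_nat s = (Inr b :: 'a + 'b)" by (metis from_nat_to_nat)
    obtain a where "?Q (insert (a, b) (set (stage ?Q s)))"
      using partial_iso_back[OF V V' Q _ b] by blast
    then show ?thesis using served[of "(a, b)" s] s by auto
  qed
  have pair: "a \<in> V \<and> b \<in> V' \<and> (a = a' \<longleftrightarrow> b = b') \<and> (E a a' \<longleftrightarrow> E' b b')"
    if "?G a b" "?G a' b'" for a b a' b'
  proof -
    obtain s t where "(a, b) \<in> set (stage ?Q s)" "(a', b') \<in> set (stage ?Q t)"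
      using \<open>?G a b\<close> \<open>?G a' b'\<close> unfolding limit_rel_def by blast
    then have "(a, b) \<in> set (stage ?Q (max s t))" "(a', b') \<in> set (stage ?Q (max s t))"
      using stage_mono[of s "max s t" ?Q] stage_mono[of t "max s t" ?Q] by auto
    then show ?thesis using partial_isoD[OF Q] by metis
  qed
  obtain g where g: "\<And>a. a \<in> V \<Longrightarrow> ?G a (g a)" using dom by metis
  have "bij_betw g V V'"
    unfolding bij_betw_def inj_on_def using g pair ran by (auto simp: image_iff) metis+
  then have "digraph_iso V E V' E' g"
    unfolding digraph_iso_def using g pair by blast
  moreover have "?G a b \<longleftrightarrow> g a = b" if "a \<in> V" for a b
    using g[OF that] pair by metis
  ultimately show ?thesis by blast
qed

section \<open>The extension property of the generic multipartite digraph\<close>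

lemma card_parts:
  fixes P :: "'a::countable set set"
  assumes P: "partition_on UNIV P"
  obtains \<iota> :: "'a set \<Rightarrow> nat" where "bij_betw \<iota> P {i. enat i < ecard P}"
proof (cases "finite P")
  case True
  then obtain \<iota> where "bij_betw \<iota> P {0..<card P}" using ex_bij_betw_finite_nat by blast
  moreover have "{i. enat i < ecard P} = {0..<card P}" using True by (auto simp: ecard_def)
  ultimately show ?thesis using that by metis
next
  case False
  \<comment> \<open>\<open>P\<close> is countable, being contained in the image of the countable
    vertex type under the map from points to their parts.\<close>
  have "P \<subseteq> (\<lambda>x. THE p. p \<in> P \<and> x \<in> p) ` UNIV"
  proof
    fix p assume p: "p \<in> P"
    then obtain x where x: "x \<in> p" using partition_onD3[OF P] by (metis ex_in_conv)
    have "(THE p. p \<in> P \<and> x \<in> p) = p"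
      using p x partition_onD2[OF P] by (intro the_equality) (auto simp: disjoint_def)
    then show "p \<in> (\<lambda>x. THE p. p \<in> P \<and> x \<in> p) ` UNIV" by (intro range_eqI[of _ _ x]) (rule sym)
  qed
  then have "countable P" by (rule countable_subset) simp
  then obtain \<iota> :: "'a set \<Rightarrow> nat" where "bij_betw \<iota> P UNIV"
    using countableE_infinite False by metis
  moreover have "{i. enat i < ecard P} = UNIV" using False by (auto simp: ecard_def)
  ultimately show ?thesis using that by metis
qed

lemma multipartite_part_function:
  fixes E :: "'a::countable \<Rightarrow> 'a \<Rightarrow> bool"
  assumes P: "multipartite_with P UNIV E"
  obtains p :: "'a \<Rightarrow> nat" where "\<And>x. enat (p x) < ecard P"
    "\<And>q. enat q < ecard P \<Longrightarrow> \<exists>x. p x = q"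
    "\<And>x y. p x = p y \<Longrightarrow> \<not> E x y"
    "\<And>x y. p x \<noteq> p y \<Longrightarrow> E x y \<or> E y x"
proof -
  have part: "partition_on UNIV P" using P unfolding multipartite_with_def by blast
  obtain \<iota> :: "'a set \<Rightarrow> nat" where \<iota>: "bij_betw \<iota> P {i. enat i < ecard P}"
    using card_parts[OF part] .
  have "\<forall>x. \<exists>A. A \<in> P \<and> x \<in> A" using partition_onD1[OF part] by blast
  then obtain \<pi> where \<pi>: "\<And>x. \<pi> x \<in> P" "\<And>x. x \<in> \<pi> x" by metis
  have uniq: "A = \<pi> x" if "A \<in> P" "x \<in> A" for A x
    using that \<pi> partition_onD2[OF part] unfolding disjoint_def by blast
  have eq: "\<pi> x = \<pi> y" if "\<iota> (\<pi> x) = \<iota> (\<pi> y)" for x y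
    using that \<iota> \<pi>(1) unfolding bij_betw_def inj_on_def by blast
  show thesis
  proof (rule that[of "\<lambda>x. \<iota> (\<pi> x)"])
    show "enat (\<iota> (\<pi> x)) < ecard P" for x
      using bij_betwE[OF \<iota>] \<pi>(1) by blast
    show "\<exists>x. \<iota> (\<pi> x) = q" if "enat q < ecard P" for q
    proof -
      have "q \<in> \<iota> ` P" using that bij_betw_imp_surj_on[OF \<iota>] by simp
      then obtain A where A: "A \<in> P" "q = \<iota> A" by blast
      moreover obtain x where "x \<in> A" using A(1) partition_onD3[OF part] by (metis ex_in_conv)
      ultimately show ?thesis using uniq by blast
    qed
    show "\<not> E x y" if "\<iota> (\<pi> x) = \<iota> (\<pi> y)" for x y
      using P \<pi> eq[OF that] unfolding multipartite_with_def by metis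
    show "E x y \<or> E y x" if "\<iota> (\<pi> x) \<noteq> \<iota> (\<pi> y)" for x y
      using P \<pi> that unfolding multipartite_with_def by metis
  qed
qed

text \<open>The parts are the nonempty fibres of \<open>c\<close>. Labels that do not occur are
  missing parts, whence only \<open>m \<le> n\<close>.\<close>

lemma complete_multipartite_labelling:
  fixes c :: "'a \<Rightarrow> nat"
  assumes W: "finite W" "digraph W F" and c: "\<And>x. x \<in> W \<Longrightarrow> enat (c x) < n"
    and F: "\<And>x y. x \<in> W \<Longrightarrow> y \<in> W \<Longrightarrow> (F x y \<or> F y x) \<longleftrightarrow> c x \<noteq> c y"
  shows "\<exists>m\<le>n. complete_multipartite m W F"
proof -
  define P where "P = (\<lambda>i. {x \<in> W. c x = i}) ` c ` W"
  have "partition_on W P"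
    by (rule partition_onI) (auto simp: P_def disjnt_def)
  moreover have "\<not> F x y" if "A \<in> P" "x \<in> A" "y \<in> A" for A x y
    using that F[of x y] unfolding P_def by auto
  moreover have "F x y \<or> F y x" if "A \<in> P" "B \<in> P" "A \<noteq> B" "x \<in> A" "y \<in> B" for A B x y
    using that F[of x y] unfolding P_def by auto
  ultimately have "multipartite_with P W F"
    using W(2) unfolding multipartite_with_def by blast
  then have "complete_multipartite (ecard P) W F" unfolding complete_multipartite_def by blast
  moreover have "ecard P \<le> n"
  proof (cases n)
    case (enat k)
    have "card P \<le> card (c ` W)" unfolding P_def using W(1) by (simp add: card_image_le)
    also have "\<dots> \<le> card {..<k}" using c enat by (intro card_mono) auto
    finally show ?thesis using W(1) enat by (simp add: ecard_def P_def)
  qed simp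
  ultimately show ?thesis by blast
qed

text \<open>Adjoin to \<open>F\<close> an abstract point \<open>w\<close> with the required arcs,
  embed the resulting finite digraph by universality, and move the copy of \<open>F\<close> back
  onto \<open>F\<close> by homogeneity. The point \<open>w\<close> lands on the required
  \<open>z\<close>.\<close>

lemma generic_multipartite_extensible:
  assumes "generic_multipartite n E"
  shows "\<exists>p. extensible n UNIV p E"
proof -
  obtain P where P: "ecard P = n" "multipartite_with P UNIV E"
    and hom: "homogeneous E"
    and univ: "\<And>(W :: nat set) F. finite W \<Longrightarrow> digraph W F \<Longrightarrow>
      \<exists>m\<le>n. complete_multipartite m W F \<Longrightarrow> \<exists>B h. digraph_iso W F B E h"
    using assms unfolding generic_multipartite_def by metis
  obtain p where p: "\<And>x. enat (p x) < n" "\<And>q. enat q < n \<Longrightarrow> \<exists>x. p x = q"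
    "\<And>x y. p x = p y \<Longrightarrow> \<not> E x y" "\<And>x y. p x \<noteq> p y \<Longrightarrow> E x y \<or> E y x"
    using multipartite_part_function[OF P(2)] unfolding P(1) by metis
  have asym: "\<not> (E x y \<and> E y x)" for x y
    using P(2) p(3)[of x x] unfolding multipartite_with_def digraph_def antisymp_on_def by auto
  have "\<exists>z\<in>UNIV - F. p z = q \<and> (\<forall>y\<in>F. p y \<noteq> q \<longrightarrow> (E z y \<longleftrightarrow> y \<in> T))"
    if F: "finite F" and q: "enat q < n" for F T q
  proof -
    obtain x0 where x0: "p x0 = q" using p(2) q by blast
    \<comment> \<open>Adding \<open>x0\<close> makes any automorphism that fixes \<open>X\<close> pointwise fix the part \<open>q\<close>.\<close>
    define X where "X = insert x0 F"
    have X: "finite X" using F X_def by simp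
    \<comment> \<open>A fresh name only: \<open>c\<close> and \<open>G\<close> override the part and
      the arcs that \<open>w\<close> has in \<open>E\<close>.\<close>
    obtain w where w: "w \<notin> X" using ex_new_if_finite[OF infinite_UNIV_nat X] by blast
    define c where "c = (\<lambda>x. if x = w then q else p x)"
    define G where "G = (\<lambda>x y. x \<in> insert w X \<and> y \<in> insert w X \<and> c x \<noteq> c y \<and>
      (if x = w then y \<in> T else if y = w then x \<notin> T else E x y))"
    have Gc: "(G x y \<or> G y x) \<longleftrightarrow> c x \<noteq> c y" if "x \<in> insert w X" "y \<in> insert w X" for x y
      using that p(4)[of x y] unfolding G_def c_def by auto
    have "\<not> (G x y \<and> G y x)" for x y
      using asym[of x y] unfolding G_def by (auto split: if_splits)
    then have "antisymp_on (insert w X) G" unfolding antisymp_on_def by blast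
    then have G: "digraph (insert w X) G"
      unfolding digraph_def irreflp_on_def by (simp add: G_def)
    have "\<exists>m\<le>n. complete_multipartite m (insert w X) G"
      using X G Gc p(1) q by (intro complete_multipartite_labelling[where c = c]) (auto simp: c_def)
    then obtain B h where h: "digraph_iso (insert w X) G B E h"
      using univ[OF _ G] X by blast
    then have inj: "inj_on h (insert w X)"
      and hG: "\<And>x y. x \<in> insert w X \<Longrightarrow> y \<in> insert w X \<Longrightarrow> G x y \<longleftrightarrow> E (h x) (h y)"
      unfolding digraph_iso_def bij_betw_def by blast+
    have injX: "inj_on h X" using inj by (rule inj_on_subset) auto
    have GE: "G x y \<longleftrightarrow> E x y" if "x \<in> X" "y \<in> X" for x y
      using that w p(3)[of x y] unfolding G_def c_def by auto
    \<comment> \<open>\<open>G\<close> agrees with \<open>E\<close> on \<open>X\<close>, so the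
      inverse of the embedding is an isomorphism between finite induced subdigraphs of
      \<open>E\<close>.\<close>
    have "digraph_iso (h ` X) E X E (inv_into X h)"
      unfolding digraph_iso_def
      using injX hG GE by (auto intro: bij_betw_inv_into inj_on_imp_bij_betw)
    then obtain \<alpha> where \<alpha>: "\<alpha> \<in> Aut E" "\<And>x. x \<in> X \<Longrightarrow> \<alpha> (h x) = x"
      using hom X injX unfolding homogeneous_def by (metis (no_types, lifting) finite_imageI imageI inv_into_f_f)
    then have \<alpha>E: "E (\<alpha> x) (\<alpha> y) \<longleftrightarrow> E x y" and \<alpha>inj: "inj \<alpha>" for x y
      unfolding Aut_def digraph_iso_def bij_betw_def by auto
    define z where "z = \<alpha> (h w)"
    have z: "(E z y \<longleftrightarrow> G w y) \<and> (E y z \<longleftrightarrow> G y w)" if "y \<in> X" for y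
      using that hG[of w y] hG[of y w] \<alpha>E[of "h w" "h y"] \<alpha>E[of "h y" "h w"] \<alpha>(2)[OF that]
      unfolding z_def by auto
    have "z \<notin> X"
    proof
      assume "z \<in> X"
      then have "\<alpha> (h z) = \<alpha> (h w)" using \<alpha>(2) z_def by simp
      then have "h z = h w" using \<alpha>inj by (simp add: inj_eq)
      then show False using inj \<open>z \<in> X\<close> w by (auto simp: inj_on_def)
    qed
    \<comment> \<open>\<open>w\<close> and \<open>x0\<close> have the same label, hence are not
      joined in \<open>G\<close>; so \<open>z\<close> is not joined to \<open>x0\<close> and shares
      its part.\<close>
    moreover have "p z = q"
    proof (rule ccontr)
      assume "p z \<noteq> q"
      then have "G w x0 \<or> G x0 w" using z[of x0] p(4)[of z x0] x0 by (auto simp: X_def)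
      then show False using Gc[of w x0] w x0 by (auto simp: X_def c_def)
    qed
    moreover have "E z y \<longleftrightarrow> y \<in> T" if "y \<in> F" "p y \<noteq> q" for y
      using that z[of y] w unfolding G_def c_def X_def by auto
    ultimately show ?thesis unfolding X_def by blast
  qed
  moreover have "E y x \<longleftrightarrow> \<not> E x y" if "p x \<noteq> p y" for x y
    using asym[of x y] p(4)[OF that] by blast
  ultimately have "extensible n UNIV p E"
    using p(1,3) by (intro extensibleI)
  then show ?thesis by (rule exI[of _ p])
qed

section \<open>The digraph attached to a structure\<close>

text \<open>\<open>Elem u j\<close> stands for the element \<open>u\<close> as a \<open>j\<close>-th entry of tuples, and \<open>Hub u\<close> ties all
  these together. \<open>Base b r\<close> is the \<open>r\<close>-th point of the cycle that replaces the node \<open>b\<close>, while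
  \<open>Wit q k xs\<close> is a witness in the part \<open>q\<close> singling out \<open>xs\<close>.\<close>

datatype 'a node = Elem 'a nat | Hub 'a | Tuple nat "'a list"

datatype 'a vertex = Base "'a node" int | Wit nat int "'a vertex list"

instance node :: (countable) countable
  by countable_datatype

instance vertex :: (countable) countable
  by countable_datatype

text \<open>The colors are positive, determine the kind of node and its indices, and are \<open>1\<close> for
  hubs only, so that hubs become the fixed points of the automorphism.\<close>

fun color :: "'a node \<Rightarrow> nat" where
  "color (Elem u j) = 2 * j + 2"
| "color (Hub u) = 1"
| "color (Tuple i xs) = 2 * i + 3"

text \<open>Links only join copies of elements to hubs or tuples, so the incidence digraph is
  bipartite and fits into two parts, whatever \<open>n \<ge> 2\<close> is.\<close>

fun node_part :: "'a node \<Rightarrow> nat" where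
  "node_part (Elem u j) = 0"
| "node_part (Hub u) = 1"
| "node_part (Tuple i xs) = 1"

fun linked :: "'a node \<Rightarrow> 'a node \<Rightarrow> bool" where
  "linked (Elem u j) (Hub v) \<longleftrightarrow> u = v"
| "linked (Elem u j) (Tuple i xs) \<longleftrightarrow> j < length xs \<and> xs ! j = u"
| "linked _ _ \<longleftrightarrow> False"

fun node_in :: "code \<Rightarrow> nat node \<Rightarrow> bool" where
  "node_in M (Elem u j) \<longleftrightarrow> fst M u"
| "node_in M (Hub u) \<longleftrightarrow> fst M u"
| "node_in M (Tuple i xs) \<longleftrightarrow> snd M i xs"

text \<open>The code \<open>M\<close> only decides which vertices are present; arcs and
  \<open>shift\<close> are defined on the whole type, independently of \<open>M\<close>.\<close>

fun vertex_in :: "enat \<Rightarrow> code \<Rightarrow> nat vertex \<Rightarrow> bool" where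
  "vertex_in n M (Base b r) \<longleftrightarrow> node_in M b \<and> 0 \<le> r \<and> r < int (color b)"
| "vertex_in n M (Wit q k xs) \<longleftrightarrow> enat q < n \<and> (\<forall>x\<in>set xs. vertex_in n M x)"

fun part :: "'a vertex \<Rightarrow> nat" where
  "part (Base b r) = node_part b"
| "part (Wit q k xs) = q"

fun refs :: "'a vertex \<Rightarrow> 'a vertex set" where
  "refs (Base b r) = {}"
| "refs (Wit q k xs) = set xs"

text \<open>Positions on the cycles are ignored: all points of two cycles are joined alike, so
  rotating cycles of different lengths preserves arcs.\<close>

fun base_linked :: "'a vertex \<Rightarrow> 'a vertex \<Rightarrow> bool" where
  "base_linked (Base b r) (Base b' r') \<longleftrightarrow> linked b b' \<or> linked b' b"
| "base_linked _ _ \<longleftrightarrow> False"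

definition related :: "'a vertex \<Rightarrow> 'a vertex \<Rightarrow> bool" where
  "related x y \<longleftrightarrow> x \<in> refs y \<or> y \<in> refs x \<or> base_linked x y"

text \<open>Arcs go from lower to higher parts except between related vertices, so that an orientation
  is the same thing as a symmetric relation.\<close>

definition arc :: "'a vertex \<Rightarrow> 'a vertex \<Rightarrow> bool" where
  "arc x y \<longleftrightarrow> part x \<noteq> part y \<and> (part x < part y \<longleftrightarrow> \<not> related x y)"

text \<open>Moving the references of a witness along with it preserves arcs, while its integer index
  keeps it from having a finite orbit.\<close>

fun shift :: "int \<Rightarrow> 'a vertex \<Rightarrow> 'a vertex" where
  "shift k (Base b r) = Base b ((r + k) mod int (color b))"
| "shift k (Wit q j xs) = Wit q (j + k) (map (shift k) xs)"

abbreviation vertices :: "enat \<Rightarrow> code \<Rightarrow> nat vertex set" where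
  "vertices n M \<equiv> {x. vertex_in n M x}"

section \<open>The action of \<open>shift\<close> on the vertices\<close>

lemma color_pos: "0 < color b"
  by (cases b) auto

lemma color_map_node [simp]: "color (map_node h b) = color b"
  by (cases b) auto

lemma node_part_map_node [simp]: "node_part (map_node h b) = node_part b"
  by (cases b) auto

lemma linked_part: "linked b b' \<Longrightarrow> node_part b = 0"
  by (cases b) auto

lemma shift_shift [simp]: "shift k (shift l x) = shift (k + l) x"
  by (induction x) (auto simp: mod_simps ac_simps)

text \<open>Restricted to actual vertices, because \<open>shift 0\<close> reduces a position
  \<open>r\<close> outside the cycle modulo its length.\<close>

lemma shift_zero: "vertex_in n M x \<Longrightarrow> shift 0 x = x"
  by (induction x) (auto intro: map_idI)

lemma vertex_in_shift: "vertex_in n M x \<Longrightarrow> vertex_in n M (shift k x)"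
  by (induction x) (auto simp: color_pos)

lemma part_shift [simp]: "part (shift k x) = part x"
  by (cases x) auto

lemma refs_shift: "refs (shift k x) = shift k ` refs x"
  by (cases x) auto

lemma base_linked_shift [simp]: "base_linked (shift k x) (shift k y) = base_linked x y"
  by (cases x; cases y) auto

lemma vertex_in_refs: "vertex_in n M x \<Longrightarrow> y \<in> refs x \<Longrightarrow> vertex_in n M y"
  by (cases x) auto

lemma shift_inj:
  assumes "vertex_in n M x" "vertex_in n M y"
  shows "shift k x = shift k y \<longleftrightarrow> x = y"
  using assms shift_zero[of n M x] shift_zero[of n M y] shift_shift[of "- k" k]
  by (metis add.left_inverse)

lemma mem_refs_shift:
  assumes "vertex_in n M x" "vertex_in n M y"
  shows "shift k x \<in> refs (shift k y) \<longleftrightarrow> x \<in> refs y"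
  using assms shift_inj[of n M x _ k] vertex_in_refs[of n M y]
  unfolding refs_shift image_iff by metis

lemma arc_shift:
  assumes "vertex_in n M x" "vertex_in n M y"
  shows "arc (shift k x) (shift k y) \<longleftrightarrow> arc x y"
  using assms by (simp add: arc_def related_def mem_refs_shift)

lemma bij_betw_shift: "bij_betw (shift k) (vertices n M) (vertices n M)"
  by (rule bij_betw_byWitness[where f' = "shift (- k)"])
    (auto simp: vertex_in_shift shift_zero)

text \<open>Thus the period of a point on a cycle reveals the color of its node.\<close>

lemma shift_Base_fixed:
  "vertex_in n M (Base b r) \<Longrightarrow> shift k (Base b r) = Base b r \<longleftrightarrow> int (color b) dvd k"
  by (simp add: mod_eq_dvd_iff[of "r + k" _ r, simplified] flip: mod_pos_pos_trivial)
    (metis add_diff_cancel_left' mod_eq_dvd_iff mod_pos_pos_trivial)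

lemma vertices_part_less: "2 \<le> n \<Longrightarrow> vertex_in n M x \<Longrightarrow> enat (part x) < n"
proof (cases x)
  case (Base b r)
  assume "2 \<le> n"
  then have "enat (part x) < 2"
    using Base by (cases b) (auto simp: numeral_eq_enat zero_enat_def one_enat_def)
  then show ?thesis using \<open>2 \<le> n\<close> by (rule less_le_trans)
qed auto

lemma vertices_extensible:
  assumes "2 \<le> n"
  shows "extensible n (vertices n M) part arc"
proof (rule extensibleI)
  show "enat (part x) < n" if "x \<in> vertices n M" for x
    using vertices_part_less assms that by simp
  show "\<not> arc x y" if "part x = part y" for x y :: "nat vertex"
    using that by (simp add: arc_def)
  have "base_linked x y = base_linked y x" for x y :: "nat vertex"
    by (cases x; cases y) auto
  then have related_sym: "related x y \<longleftrightarrow> related y x" for x y :: "nat vertex"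
    unfolding related_def by blast
  show "arc y x \<longleftrightarrow> \<not> arc x y" if "part x \<noteq> part y" for x y :: "nat vertex"
    using that related_sym[of x y] unfolding arc_def by auto
  show "\<exists>z\<in>vertices n M - F. part z = q \<and> (\<forall>y\<in>F. part y \<noteq> q \<longrightarrow> (arc z y \<longleftrightarrow> y \<in> T))"
    if F: "finite F" "F \<subseteq> vertices n M" and q: "enat q < n" for F q T
  proof -
    \<comment> \<open>The vertices of \<open>F\<close> in other parts at which the default arc, from
      lower to higher part, disagrees with \<open>T\<close>: exactly these must be related to the
      witness.\<close>
    obtain xs where xs: "set xs = {y \<in> F. q < part y \<longleftrightarrow> y \<notin> T}"
      using F(1) finite_list[of "{y \<in> F. q < part y \<longleftrightarrow> y \<notin> T}"] by auto
    \<comment> \<open>Some index \<open>k\<close> makes the witness new and not referenced by any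
      vertex of \<open>F\<close>, so that its references in \<open>xs\<close> are its only relations
      to \<open>F\<close>.\<close>
    have "finite (F \<union> (\<Union>y\<in>F. refs y))"
    proof -
      have "finite (refs y)" for y :: "nat vertex" by (cases y) auto
      then show ?thesis using F(1) by simp
    qed
    moreover have "infinite (range (\<lambda>k. Wit q k xs))"
      by (subst finite_image_iff) (auto simp: inj_on_def infinite_UNIV_char_0)
    ultimately obtain k where k: "Wit q k xs \<notin> F \<union> (\<Union>y\<in>F. refs y)"
      by (meson finite_subset image_subsetI)
    have "arc (Wit q k xs) y \<longleftrightarrow> y \<in> T" if "y \<in> F" "part y \<noteq> q" for y
      using that k xs unfolding arc_def related_def by auto
    moreover have "Wit q k xs \<in> vertices n M - F"
      using q k xs F(2) by auto
    ultimately show ?thesis by (intro bexI[of _ "Wit q k xs"]) auto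
  qed
qed

text \<open>Isomorphism of digraphs with a distinguished automorphism. Part numbers need not be
  preserved, since conjugation may involve automorphisms that permute the parts.\<close>

definition equivariant_iso :: "enat \<Rightarrow> code \<Rightarrow> code \<Rightarrow> (nat vertex \<Rightarrow> nat vertex) \<Rightarrow> bool" where
  "equivariant_iso n M M' \<theta> \<longleftrightarrow>
     digraph_iso (vertices n M) arc (vertices n M') arc \<theta> \<and>
     (\<forall>x\<in>vertices n M. \<theta> (shift 1 x) = shift 1 (\<theta> x))"

lemma equivariant_isoD:
  assumes "equivariant_iso n M M' \<theta>"
  shows "bij_betw \<theta> (vertices n M) (vertices n M')"
    and "\<And>x. vertex_in n M x \<Longrightarrow> vertex_in n M' (\<theta> x)"
    and "\<And>x y. vertex_in n M x \<Longrightarrow> vertex_in n M y \<Longrightarrow> \<theta> x = \<theta> y \<longleftrightarrow> x = y"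
    and "\<And>x y. vertex_in n M x \<Longrightarrow> vertex_in n M y \<Longrightarrow> arc (\<theta> x) (\<theta> y) \<longleftrightarrow> arc x y"
    and "\<And>x. vertex_in n M x \<Longrightarrow> \<theta> (shift 1 x) = shift 1 (\<theta> x)"
  using assms unfolding equivariant_iso_def digraph_iso_def bij_betw_def inj_on_def by blast+

lemma equivariant_iso_inv:
  assumes \<theta>: "equivariant_iso n M M' \<theta>"
  shows "equivariant_iso n M' M (inv_into (vertices n M) \<theta>)"
proof -
  note bij = equivariant_isoD(1)[OF \<theta>]
  have inv_in: "vertex_in n M (inv_into (vertices n M) \<theta> x)"
    and right: "\<theta> (inv_into (vertices n M) \<theta> x) = x" if "vertex_in n M' x" for x
    using that bij_betwE[OF bij_betw_inv_into[OF bij]] bij_betw_inv_into_right[OF bij] by auto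
  have left: "inv_into (vertices n M) \<theta> (\<theta> x) = x" if "vertex_in n M x" for x
    using that bij_betw_inv_into_left[OF bij] by auto
  have "inv_into (vertices n M) \<theta> (shift 1 x) = shift 1 (inv_into (vertices n M) \<theta> x)"
    if x: "vertex_in n M' x" for x
    using equivariant_isoD(5)[OF \<theta> inv_in[OF x]] left[OF vertex_in_shift[OF inv_in[OF x]]]
      right[OF x] by metis
  moreover have "arc x y \<longleftrightarrow>
      arc (inv_into (vertices n M) \<theta> x) (inv_into (vertices n M) \<theta> y)"
    if "vertex_in n M' x" "vertex_in n M' y" for x y
    using equivariant_isoD(4)[OF \<theta>] inv_in right that by metis
  ultimately show ?thesis
    unfolding equivariant_iso_def digraph_iso_def using bij_betw_inv_into[OF bij] by simp
qed

section \<open>From isomorphisms of structures to equivariant isomorphisms\<close>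

lemma structures_tuple:
  "M \<in> structures L ar \<Longrightarrow> snd M i xs \<Longrightarrow> i \<in> L \<and> length xs = ar i \<and> set xs \<subseteq> Collect (fst M)"
  by (cases M) (simp add: structures_def)

lemma node_set: "M \<in> structures L ar \<Longrightarrow> node_in M b \<Longrightarrow> set_node b \<subseteq> Collect (fst M)"
  using structures_tuple[of M L ar] by (cases b) auto

lemma vertex_set:
  "M \<in> structures L ar \<Longrightarrow> vertex_in n M x \<Longrightarrow> set_vertex x \<subseteq> Collect (fst M)"
proof (induction x)
  case (Base b r)
  then show ?case using node_set[of M L ar b] by simp
qed auto

lemma part_map_vertex [simp]: "part (map_vertex h x) = part x"
  by (cases x) auto

lemma refs_map_vertex: "refs (map_vertex h x) = map_vertex h ` refs x"
  by (cases x) auto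

lemma shift_map_vertex: "shift k (map_vertex h x) = map_vertex h (shift k x)"
  by (induction x) auto

lemma linked_map_node:
  "inj_on h A \<Longrightarrow> set_node b \<subseteq> A \<Longrightarrow> set_node b' \<subseteq> A \<Longrightarrow>
    linked (map_node h b) (map_node h b') \<longleftrightarrow> linked b b'"
  by (cases b; cases b') (auto simp: inj_on_eq_iff subset_iff)

lemma vertex_in_map_vertex:
  assumes "\<And>b. node_in M b \<Longrightarrow> node_in M' (map_node h b)"
  shows "vertex_in n M x \<Longrightarrow> vertex_in n M' (map_vertex h x)"
  by (induction x) (auto simp: assms)

text \<open>The isomorphism \<open>h\<close> renames the elements inside all vertices; colors, parts
  and shifts do not see the names.\<close>

lemma equivariant_iso_map_vertex:
  assumes M: "M \<in> structures L ar" and M': "M' \<in> structures L ar"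
    and h: "bij_betw h (Collect (fst M)) (Collect (fst M'))"
    and R: "\<And>i xs. i \<in> L \<Longrightarrow> length xs = ar i \<Longrightarrow> set xs \<subseteq> Collect (fst M) \<Longrightarrow>
      snd M i xs \<longleftrightarrow> snd M' i (map h xs)"
  shows "equivariant_iso n M M' (map_vertex h)"
proof -
  define k where "k = inv_into (Collect (fst M)) h"
  have inj: "inj_on h (Collect (fst M))" using h by (simp add: bij_betw_def)
  have h_in: "fst M' (h u)" if "fst M u" for u using h that by (auto simp: bij_betw_def)
  have k_in: "fst M (k u)" if "fst M' u" for u
    using bij_betwE[OF bij_betw_inv_into[OF h]] that unfolding k_def by auto
  have kh: "k (h u) = u" if "fst M u" for u
    using that bij_betw_inv_into_left[OF h] unfolding k_def by simp
  have hk: "h (k u) = u" if "fst M' u" for u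
    using that bij_betw_inv_into_right[OF h] unfolding k_def by simp
  note str = structures_tuple[OF M] and str' = structures_tuple[OF M']
  have node: "node_in M' (map_node h b)" if "node_in M b" for b
  proof (cases b)
    case (Tuple i xs)
    then show ?thesis using that str[of i xs] R[of i xs] by simp
  qed (use that h_in in auto)
  have node': "node_in M (map_node k b)" if "node_in M' b" for b
  proof (cases b)
    case (Tuple i xs)
    then have xs: "snd M' i xs" using that by simp
    have "map h (map k xs) = xs" using str'[OF xs] hk by (auto intro!: map_idI)
    moreover have "set (map k xs) \<subseteq> Collect (fst M)" using str'[OF xs] k_in by auto
    ultimately have "snd M i (map k xs)" using R[of i "map k xs"] str'[OF xs] xs by simp
    then show ?thesis using Tuple by simp
  qed (use that k_in in auto)
  \<comment> \<open>\<open>h\<close> is inverted by \<open>k\<close> only on the universe;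
    \<open>vertex_set\<close> says that all elements named in a vertex belong to it.\<close>
  have left: "map_vertex k (map_vertex h x) = x" if "vertex_in n M x" for x
    using vertex_set[OF M that] kh
    by (subst vertex.map_comp) (auto intro!: vertex.map_ident_strong)
  have right: "map_vertex h (map_vertex k x) = x" if "vertex_in n M' x" for x
    using vertex_set[OF M' that] hk
    by (subst vertex.map_comp) (auto intro!: vertex.map_ident_strong)
  have "bij_betw (map_vertex h) (vertices n M) (vertices n M')"
  proof (rule bij_betw_byWitness[where f' = "map_vertex k"])
    show "map_vertex h ` vertices n M \<subseteq> vertices n M'"
      using vertex_in_map_vertex[of M M' h n, OF node] by blast
    show "map_vertex k ` vertices n M' \<subseteq> vertices n M"
      using vertex_in_map_vertex[of M' M k n, OF node'] by blast
  qed (use left right in simp_all)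
  moreover have "arc x y \<longleftrightarrow> arc (map_vertex h x) (map_vertex h y)"
    if xy: "vertex_in n M x" "vertex_in n M y" for x y
  proof -
    have refs: "map_vertex h x \<in> refs (map_vertex h y) \<longleftrightarrow> x \<in> refs y"
      if "vertex_in n M x" "vertex_in n M y" for x y
      using that left vertex_in_refs[of n M y] unfolding refs_map_vertex image_iff by metis
    have "base_linked (map_vertex h x) (map_vertex h y) \<longleftrightarrow> base_linked x y"
      using xy by (cases x; cases y) (auto simp: linked_map_node[OF inj] node_set[OF M])
    then show ?thesis using refs xy by (simp add: arc_def related_def)
  qed
  ultimately show ?thesis
    unfolding equivariant_iso_def digraph_iso_def by (simp add: shift_map_vertex)
qed

section \<open>Recovering the structure from an equivariant isomorphism\<close>

lemma arc_Base:
  "node_part b = 0 \<Longrightarrow> node_part b' = 1 \<Longrightarrow> arc (Base b r) (Base b' r') \<longleftrightarrow> \<not> linked b b'"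
  \<comment> \<open>Links start in part 0, so the converse link is excluded; hence an arc between
    parts 0 and 1 decodes one direction of \<open>linked\<close>.\<close>
  using linked_part[of b' b] by (auto simp: arc_def related_def)

text \<open>An equivariant map preserves periods under \<open>shift\<close>: cycle points have their
  color as period, whereas witnesses have none.\<close>

lemma equivariant_iso_Base:
  assumes \<theta>: "equivariant_iso n M M' \<theta>" and b: "vertex_in n M (Base b r)"
  shows "\<exists>b' r'. \<theta> (Base b r) = Base b' r' \<and> vertex_in n M' (Base b' r') \<and> color b' = color b"
proof -
  have iter: "\<theta> (shift (int k) x) = shift (int k) (\<theta> x)" if x: "vertex_in n M x" for k x
  proof (induction k)
    case 0
    then show ?case using shift_zero[OF x] shift_zero[OF equivariant_isoD(2)[OF \<theta> x]] by simp
  next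
    case (Suc k)
    then show ?case
      using equivariant_isoD(5)[OF \<theta> vertex_in_shift[OF x, of "int k"]] by (simp add: add.commute)
  qed
  have fixed: "shift (int k) (\<theta> (Base b r)) = \<theta> (Base b r) \<longleftrightarrow> color b dvd k" for k
    using iter[OF b, of k] equivariant_isoD(3)[OF \<theta> vertex_in_shift[OF b] b, of "int k"]
      shift_Base_fixed[OF b, of "int k"] by simp
  have in': "vertex_in n M' (\<theta> (Base b r))" using equivariant_isoD(2)[OF \<theta> b] .
  show ?thesis
  proof (cases "\<theta> (Base b r)")
    case (Base b' r')
    have "color b' dvd k \<longleftrightarrow> color b dvd k" for k
      using fixed[of k] shift_Base_fixed[of n M' b' r' "int k"] in' Base by simp
    then have "color b' = color b" by (metis dvd_antisym dvd_refl)
    then show ?thesis using Base in' by simp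
  next
    case (Wit q j xs)
    then show ?thesis using fixed[of "color b"] color_pos[of b] by simp
  qed
qed

text \<open>Hubs are the fixed points, so \<open>\<theta>\<close> induces a map \<open>h\<close> of
  elements. A link to its hub identifies each copy of an element, and links to these copies identify
  the entries of a tuple. The converse implication for relations will come from the inverse of
  \<open>\<theta>\<close>.\<close>

lemma equivariant_iso_elements:
  assumes \<theta>: "equivariant_iso n M M' \<theta>"
    and M: "M \<in> structures L ar" and M': "M' \<in> structures L ar"
  shows "\<exists>h. (\<forall>u. fst M u \<longrightarrow> fst M' (h u) \<and> \<theta> (Base (Hub u) 0) = Base (Hub (h u)) 0) \<and>
    (\<forall>i xs. snd M i xs \<longrightarrow> snd M' i (map h xs))"
proof -
  have "\<exists>v. fst M' v \<and> \<theta> (Base (Hub u) 0) = Base (Hub v) 0" if u: "fst M u" for u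
  proof -
    obtain b r where b: "\<theta> (Base (Hub u) 0) = Base b r" "vertex_in n M' (Base b r)" "color b = 1"
      using equivariant_iso_Base[OF \<theta>, of "Hub u" 0] u by auto
    then obtain v where "b = Hub v" by (cases b) auto
    then show ?thesis using b by auto
  qed
  then obtain h where h: "\<And>u. fst M u \<Longrightarrow> fst M' (h u)"
    "\<And>u. fst M u \<Longrightarrow> \<theta> (Base (Hub u) 0) = Base (Hub (h u)) 0" by metis
  \<comment> \<open>Colors fix the kinds of the image nodes, so their parts are known and the
    preserved arcs determine the links.\<close>
  have link: "linked b c \<longleftrightarrow> linked b' c'"
    if "node_part b = 0" "node_part c = 1" "node_part b' = 0" "node_part c' = 1"
      "vertex_in n M (Base b 0)" "vertex_in n M (Base c 0)"
      "\<theta> (Base b 0) = Base b' r" "\<theta> (Base c 0) = Base c' s" for b c b' c' r s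
    using equivariant_isoD(4)[OF \<theta> that(5,6)] that by (simp add: arc_Base)
  have elem: "\<exists>r. \<theta> (Base (Elem u j) 0) = Base (Elem (h u) j) r" if u: "fst M u" for u j
  proof -
    obtain b r where b: "\<theta> (Base (Elem u j) 0) = Base b r" "color b = 2 * j + 2"
      using equivariant_iso_Base[OF \<theta>, of "Elem u j" 0] u by auto
    then obtain v where v: "b = Elem v j" by (cases b) (auto, presburger)
    then have "v = h u" using link[of "Elem u j" "Hub u" b "Hub (h u)" r 0] u b h(2)[OF u] by simp
    then show ?thesis using b v by auto
  qed
  have "snd M' i (map h xs)" if R: "snd M i xs" for i xs
  proof -
    obtain b r where b: "\<theta> (Base (Tuple i xs) 0) = Base b r" "vertex_in n M' (Base b r)"
      "color b = 2 * i + 3"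
      using equivariant_iso_Base[OF \<theta>, of "Tuple i xs" 0] R by auto
    then obtain ys where ys: "b = Tuple i ys" by (cases b) (auto, presburger)
    have R': "snd M' i ys" using b ys by simp
    \<comment> \<open>Both tuples belong to the same symbol \<open>i\<close>, hence have the same
      arity.\<close>
    have len: "length ys = length xs" and sub: "set xs \<subseteq> Collect (fst M)"
      using structures_tuple[OF M R] structures_tuple[OF M' R'] by simp_all
    \<comment> \<open>The link from \<open>Elem (xs ! j) j\<close> to the tuple is carried to one
      from \<open>Elem (h (xs ! j)) j\<close> to \<open>Tuple i ys\<close>.\<close>
    have "ys ! j = h (xs ! j)" if j: "j < length xs" for j
    proof -
      have u: "fst M (xs ! j)" using sub j nth_mem by blast
      obtain s where s: "\<theta> (Base (Elem (xs ! j) j) 0) = Base (Elem (h (xs ! j)) j) s"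
        using elem[OF u] by blast
      show ?thesis using link[OF _ _ _ _ _ _ s b(1)] u R j ys by simp
    qed
    then have "ys = map h xs" using len by (intro nth_equalityI) auto
    then show ?thesis using R' by simp
  qed
  then show ?thesis using h by blast
qed

lemma structure_isomorphism_iff:
  "(M, M') \<in> structure_isomorphism L ar \<longleftrightarrow> M \<in> structures L ar \<and> M' \<in> structures L ar \<and>
     (\<exists>h. bij_betw h (Collect (fst M)) (Collect (fst M')) \<and>
       (\<forall>i\<in>L. \<forall>xs. length xs = ar i \<longrightarrow> set xs \<subseteq> Collect (fst M) \<longrightarrow>
         (snd M i xs \<longleftrightarrow> snd M' i (map h xs))))"
  by (cases M; cases M') (simp only: structure_isomorphism_def mem_Collect_eq split fst_conv snd_conv)

text \<open>For the converse, \<open>\<theta>\<close> and its inverse induce maps \<open>h\<close>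
  and \<open>k\<close> that are mutually inverse because both are read off the hubs, and each of
  them preserves the relations.\<close>

lemma structure_isomorphism_iff_equivariant_iso:
  assumes M: "M \<in> structures L ar" and M': "M' \<in> structures L ar"
  shows "(M, M') \<in> structure_isomorphism L ar \<longleftrightarrow> (\<exists>\<theta>. equivariant_iso n M M' \<theta>)"
proof
  assume "(M, M') \<in> structure_isomorphism L ar"
  then obtain h where "bij_betw h (Collect (fst M)) (Collect (fst M'))"
    "\<And>i xs. i \<in> L \<Longrightarrow> length xs = ar i \<Longrightarrow> set xs \<subseteq> Collect (fst M) \<Longrightarrow>
      snd M i xs \<longleftrightarrow> snd M' i (map h xs)"
    unfolding structure_isomorphism_iff by blast
  then show "\<exists>\<theta>. equivariant_iso n M M' \<theta>"
    using equivariant_iso_map_vertex[OF M M'] by blast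
next
  assume "\<exists>\<theta>. equivariant_iso n M M' \<theta>"
  then obtain \<theta> where \<theta>: "equivariant_iso n M M' \<theta>" ..
  define \<theta>' where "\<theta>' = inv_into (vertices n M) \<theta>"
  have \<theta>': "equivariant_iso n M' M \<theta>'" unfolding \<theta>'_def by (rule equivariant_iso_inv[OF \<theta>])
  obtain h where h: "\<And>u. fst M u \<Longrightarrow> fst M' (h u)"
      "\<And>u. fst M u \<Longrightarrow> \<theta> (Base (Hub u) 0) = Base (Hub (h u)) 0"
      "\<And>i xs. snd M i xs \<Longrightarrow> snd M' i (map h xs)"
    using equivariant_iso_elements[OF \<theta> M M'] by blast
  obtain k where k: "\<And>u. fst M' u \<Longrightarrow> fst M (k u)"
      "\<And>u. fst M' u \<Longrightarrow> \<theta>' (Base (Hub u) 0) = Base (Hub (k u)) 0"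
      "\<And>i xs. snd M' i xs \<Longrightarrow> snd M i (map k xs)"
    using equivariant_iso_elements[OF \<theta>' M' M] by blast
  note bij = equivariant_isoD(1)[OF \<theta>]
  have kh: "k (h u) = u" if u: "fst M u" for u
  proof -
    have "\<theta>' (\<theta> (Base (Hub u) 0)) = Base (Hub u) 0"
      unfolding \<theta>'_def using bij_betw_inv_into_left[OF bij] u by simp
    then show ?thesis using h(1,2)[OF u] k(2) by simp
  qed
  have hk: "h (k u) = u" if u: "fst M' u" for u
  proof -
    have "\<theta> (\<theta>' (Base (Hub u) 0)) = Base (Hub u) 0"
      unfolding \<theta>'_def using bij_betw_inv_into_right[OF bij] u by simp
    then show ?thesis using k(1,2)[OF u] h(2) by simp
  qed
  have "bij_betw h (Collect (fst M)) (Collect (fst M'))"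
    by (rule bij_betw_byWitness[where f' = k]) (use h(1) k(1) kh hk in auto)
  moreover have "snd M i xs \<longleftrightarrow> snd M' i (map h xs)" if "set xs \<subseteq> Collect (fst M)" for i xs
  proof -
    have "map k (map h xs) = xs" using that kh by (auto intro!: map_idI)
    then show ?thesis using h(3)[of i xs] k(3)[of i "map h xs"] by auto
  qed
  ultimately show "(M, M') \<in> structure_isomorphism L ar"
    unfolding structure_isomorphism_iff using M M' by blast
qed

section \<open>The reduction\<close>

definition transport :: "enat \<Rightarrow> code \<Rightarrow> (nat vertex \<Rightarrow> 'a) \<Rightarrow> 'a \<Rightarrow> 'a" where
  "transport n M g b = g (shift 1 (inv_into (vertices n M) g b))"

section \<open>Transporting \<open>shift\<close> to the given digraph; conjugacy\<close>

lemma digraph_iso_compose: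
  "digraph_iso U D V E f \<Longrightarrow> digraph_iso V E W F g \<Longrightarrow> digraph_iso U D W F (g \<circ> f)"
  unfolding digraph_iso_def bij_betw_def by (auto intro: comp_inj_on)

lemma digraph_iso_inv_into:
  assumes "digraph_iso V E W F f"
  shows "digraph_iso W F V E (inv_into V f)"
proof -
  have f: "bij_betw f V W" using assms unfolding digraph_iso_def by blast
  then have "f (inv_into V f x) = x" "inv_into V f x \<in> V" if "x \<in> W" for x
    using that bij_betw_inv_into_right[OF f] bij_betwE[OF bij_betw_inv_into[OF f]] by auto
  then show ?thesis using assms bij_betw_inv_into[OF f] unfolding digraph_iso_def by simp
qed

lemma digraph_iso_shift: "digraph_iso (vertices n M) arc (vertices n M) arc (shift k)"
  unfolding digraph_iso_def using bij_betw_shift arc_shift by blast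

lemma transport_Aut:
  assumes "digraph_iso (vertices n M) arc UNIV E g"
  shows "transport n M g \<in> Aut E"
proof -
  have "transport n M g = g \<circ> (shift 1 \<circ> inv_into (vertices n M) g)"
    by (auto simp: transport_def)
  then show ?thesis unfolding Aut_def
    using digraph_iso_compose[OF digraph_iso_compose[OF digraph_iso_inv_into[OF assms] digraph_iso_shift] assms]
    by simp
qed

text \<open>Conjugating automorphisms \<open>\<delta>\<close> and equivariant isomorphisms
  \<open>\<theta>\<close> correspond to each other by
  \<open>\<delta> \<circ> g = g' \<circ> \<theta>\<close> on the vertices.\<close>

lemma transport_conjugacy:
  assumes g: "digraph_iso (vertices n M) arc UNIV E g"
    and g': "digraph_iso (vertices n M') arc UNIV E g'"
  shows "(transport n M g, transport n M' g') \<in> conjugacy E \<longleftrightarrow> (\<exists>\<theta>. equivariant_iso n M M' \<theta>)"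
proof -
  let ?i = "inv_into (vertices n M) g" and ?i' = "inv_into (vertices n M') g'"
  have bg: "bij_betw g (vertices n M) UNIV" and bg': "bij_betw g' (vertices n M') UNIV"
    using g g' unfolding digraph_iso_def by blast+
  have gi: "g (?i b) = b" "vertex_in n M (?i b)" for b
    using bij_betw_inv_into_right[OF bg] bij_betwE[OF bij_betw_inv_into[OF bg]] by auto
  have gi': "g' (?i' b) = b" "vertex_in n M' (?i' b)" for b
    using bij_betw_inv_into_right[OF bg'] bij_betwE[OF bij_betw_inv_into[OF bg']] by auto
  have ig: "?i (g x) = x" if "vertex_in n M x" for x
    using bij_betw_inv_into_left[OF bg] that by simp
  have ig': "?i' (g' x) = x" if "vertex_in n M' x" for x
    using bij_betw_inv_into_left[OF bg'] that by simp
  show ?thesis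
  proof
    assume "(transport n M g, transport n M' g') \<in> conjugacy E"
    then obtain \<delta> where \<delta>: "\<delta> \<in> Aut E" "transport n M' g' = \<delta> \<circ> transport n M g \<circ> inv \<delta>"
      unfolding conjugacy_def by auto
    have \<delta>iso: "digraph_iso UNIV E UNIV E \<delta>" using \<delta>(1) unfolding Aut_def by simp
    then have "inj \<delta>" unfolding digraph_iso_def bij_betw_def by blast
    then have com: "transport n M' g' (\<delta> b) = \<delta> (transport n M g b)" for b
      using \<delta>(2) by simp
    have "?i' (\<delta> (g (shift 1 x))) = shift 1 (?i' (\<delta> (g x)))" if "vertex_in n M x" for x
    proof -
      have "\<delta> (g (shift 1 x)) = g' (shift 1 (?i' (\<delta> (g x))))"
        using com[of "g x"] ig[OF that] by (simp add: transport_def)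
      then show ?thesis using ig'[OF vertex_in_shift[OF gi'(2)]] by simp
    qed
    then have "equivariant_iso n M M' (?i' \<circ> (\<delta> \<circ> g))"
      unfolding equivariant_iso_def
      using digraph_iso_compose[OF digraph_iso_compose[OF g \<delta>iso] digraph_iso_inv_into[OF g']]
      by simp
    then show "\<exists>\<theta>. equivariant_iso n M M' \<theta>" by blast
  next
    assume "\<exists>\<theta>. equivariant_iso n M M' \<theta>"
    then obtain \<theta> where \<theta>: "equivariant_iso n M M' \<theta>" ..
    define \<delta> where "\<delta> = g' \<circ> (\<theta> \<circ> ?i)"
    have \<theta>iso: "digraph_iso (vertices n M) arc (vertices n M') arc \<theta>"
      using \<theta> unfolding equivariant_iso_def by blast
    have \<delta>: "\<delta> \<in> Aut E"
      unfolding Aut_def \<delta>_def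
      using digraph_iso_compose[OF digraph_iso_compose[OF digraph_iso_inv_into[OF g] \<theta>iso] g'] by simp
    then have "bij \<delta>" unfolding Aut_def digraph_iso_def by simp
    have com: "transport n M' g' (\<delta> b) = \<delta> (transport n M g b)" for b
      using ig'[OF equivariant_isoD(2)[OF \<theta> gi(2)]] ig[OF vertex_in_shift[OF gi(2)]]
        equivariant_isoD(5)[OF \<theta> gi(2)]
      by (simp add: transport_def \<delta>_def)
    have "transport n M' g' = \<delta> \<circ> transport n M g \<circ> inv \<delta>"
    proof
      fix b
      show "transport n M' g' b = (\<delta> \<circ> transport n M g \<circ> inv \<delta>) b"
        using com[of "inv \<delta> b"] \<open>bij \<delta>\<close> by (simp add: bij_is_surj surj_f_inv_f)
    qed
    then show "(transport n M g, transport n M' g') \<in> conjugacy E"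
      using \<delta> transport_Aut[OF g] transport_Aut[OF g'] unfolding conjugacy_def by blast
  qed
qed

section \<open>Measurability in the code\<close>

lemma pred_borel_continuous_bool:
  fixes P :: "'a::topological_space \<Rightarrow> bool"
  assumes "continuous_on UNIV P"
  shows "Measurable.pred borel P"
proof -
  have "open (P -` {True})" using assms by (intro open_vimage) (auto intro: open_discrete)
  then have "P -` {True} \<in> sets borel" by (rule borel_open)
  then show ?thesis by (simp add: pred_def vimage_def)
qed

text \<open>Membership of a fixed vertex depends on finitely many coordinates of the code.\<close>

lemma measurable_vertex_in: "Measurable.pred borel (\<lambda>M. vertex_in n M x)"
proof -
  have "continuous_on UNIV (\<lambda>M :: code. fst M u)" for u
    by (rule continuous_on_product_then_coordinatewise[OF continuous_on_fst[OF continuous_on_id]])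
  then have [measurable]: "Measurable.pred borel (\<lambda>M :: code. fst M u)" for u
    by (rule pred_borel_continuous_bool)
  have "continuous_on UNIV (\<lambda>M :: code. snd M i xs)" for i xs
    by (rule continuous_on_product_then_coordinatewise[OF
          continuous_on_product_then_coordinatewise[OF continuous_on_snd[OF continuous_on_id]]])
  then have [measurable]: "Measurable.pred borel (\<lambda>M :: code. snd M i xs)" for i xs
    by (rule pred_borel_continuous_bool)
  have [measurable]: "Measurable.pred borel (\<lambda>M. node_in M b)" for b
    by (cases b) simp_all
  show ?thesis
  proof (induction x)
    case (Wit q k xs)
    then show ?case by simp
  qed simp
qed

lemma borel_measurable_nat_functions:
  fixes f :: "'a \<Rightarrow> nat \<Rightarrow> nat"
  assumes "\<And>b c. Measurable.pred N (\<lambda>x. f x b = c)"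
  shows "f \<in> borel_measurable N"
proof (rule measurable_coordinatewise_then_product)
  fix b
  have "(\<lambda>x. f x b) \<in> N \<rightarrow>\<^sub>M count_space UNIV"
    using assms[of b, unfolded pred_def]
    by (simp add: measurable_count_space_eq2_countable vimage_def Int_def conj_commute)
  then show "(\<lambda>x. f x b) \<in> borel_measurable N"
    by (rule measurable_compose) simp
qed

text \<open>One map \<open>f\<close> serves all languages, as the construction never refers to
  \<open>L\<close> or \<open>ar\<close>; it is defined on every code, structure or not.\<close>

lemma structures_reduction:
  assumes "2 \<le> n" "generic_multipartite n E"
  obtains f where "f \<in> borel_measurable borel" "\<And>M. f M \<in> Aut E"
    "\<And>L ar M M'. M \<in> structures L ar \<Longrightarrow> M' \<in> structures L ar \<Longrightarrow>
      (f M, f M') \<in> conjugacy E \<longleftrightarrow> (M, M') \<in> structure_isomorphism L ar"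
proof -
  obtain p where p: "extensible n UNIV p E"
    using generic_multipartite_extensible[OF assms(2)] by blast
  define Q where "Q = (\<lambda>M. partial_iso (vertices n M) part arc UNIV p E)"
  have "\<forall>M. \<exists>g. digraph_iso (vertices n M) arc UNIV E g \<and>
      (\<forall>a\<in>vertices n M. \<forall>b. limit_rel (Q M) a b \<longleftrightarrow> g a = b)"
    unfolding Q_def using back_and_forth[OF vertices_extensible[OF assms(1)] p] by blast
  then obtain g where g: "\<And>M. digraph_iso (vertices n M) arc UNIV E (g M)"
    "\<And>M a b. vertex_in n M a \<Longrightarrow> limit_rel (Q M) a b \<longleftrightarrow> g M a = b" by (metis mem_Collect_eq)
  note measurable_vertex_in[measurable]
  have "Measurable.pred borel (\<lambda>M. Q M (set l))" for l
    unfolding Q_def partial_iso_def by simp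
  then have [measurable]: "Measurable.pred borel (\<lambda>M. limit_rel (Q M) a b)" for a b
    by (rule measurable_limit_rel)
  \<comment> \<open>This replaces \<open>g M\<close> and its inverse by a countable disjunction of
    conditions that are already known to be measurable.\<close>
  have eq: "transport n M (g M) b = c \<longleftrightarrow>
      (\<exists>x. vertex_in n M x \<and> limit_rel (Q M) x b \<and> limit_rel (Q M) (shift 1 x) c)" for M b c
  proof -
    have bij: "bij_betw (g M) (vertices n M) UNIV" using g(1) unfolding digraph_iso_def by blast
    obtain x where x: "vertex_in n M x" "g M x = b"
      using bij unfolding bij_betw_def by (metis UNIV_I imageE mem_Collect_eq)
    have uniq: "y = x" if "vertex_in n M y" "g M y = b" for y
      using bij x that unfolding bij_betw_def inj_on_def by simp
    have "transport n M (g M) b = g M (shift 1 x)"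
      unfolding transport_def using bij_betw_inv_into_left[OF bij] x by auto
    then show ?thesis using x uniq g(2) vertex_in_shift by metis
  qed
  show thesis
  proof (rule that)
    show "(\<lambda>M. transport n M (g M)) \<in> borel_measurable borel"
      by (rule borel_measurable_nat_functions) (unfold eq, measurable)
    show "transport n M (g M) \<in> Aut E" for M by (rule transport_Aut[OF g(1)])
    show "(transport n M (g M), transport n M' (g M')) \<in> conjugacy E \<longleftrightarrow>
        (M, M') \<in> structure_isomorphism L ar"
      if "M \<in> structures L ar" "M' \<in> structures L ar" for L ar M M'
      using transport_conjugacy[OF g(1) g(1)] structure_isomorphism_iff_equivariant_iso[OF that]
      by blast
  qed
qed

section \<open>Tournaments as structures with one binary relation\<close>

definition tournament_code :: "(nat \<Rightarrow> bool) \<times> (nat \<Rightarrow> nat \<Rightarrow> bool) \<Rightarrow> code" where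
  "tournament_code T = (fst T, \<lambda>i xs. i = 0 \<and> length xs = 2 \<and> snd T (xs ! 0) (xs ! 1))"

lemma tournament_code_structures:
  assumes "T \<in> countable_tournaments"
  shows "tournament_code T \<in> structures {0} (\<lambda>_. 2)"
proof -
  have "fst T x \<and> fst T y" if "snd T x y" for x y
    using assms that unfolding countable_tournaments_def tournament_def digraph_def by auto
  then show ?thesis
    by (auto simp: structures_def tournament_code_def numeral_2_eq_2 length_Suc_conv)
qed

lemma tournament_code_isomorphism:
  assumes "T \<in> countable_tournaments" "T' \<in> countable_tournaments"
  shows "(tournament_code T, tournament_code T') \<in> structure_isomorphism {0} (\<lambda>_. 2) \<longleftrightarrow>
    (T, T') \<in> tournament_isomorphism"
proof -
  have "(\<forall>xs. length xs = 2 \<longrightarrow> set xs \<subseteq> A \<longrightarrow>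
      (D (xs ! 0) (xs ! 1) \<longleftrightarrow> D' (map h xs ! 0) (map h xs ! 1))) \<longleftrightarrow>
    (\<forall>x\<in>A. \<forall>y\<in>A. D x y \<longleftrightarrow> D' (h x) (h y))" for A D D' and h :: "nat \<Rightarrow> nat"
  proof
    assume *: "\<forall>xs. length xs = 2 \<longrightarrow> set xs \<subseteq> A \<longrightarrow>
      (D (xs ! 0) (xs ! 1) \<longleftrightarrow> D' (map h xs ! 0) (map h xs ! 1))"
    show "\<forall>x\<in>A. \<forall>y\<in>A. D x y \<longleftrightarrow> D' (h x) (h y)"
    proof (intro ballI)
      show "D x y \<longleftrightarrow> D' (h x) (h y)" if "x \<in> A" "y \<in> A" for x y
        using *[rule_format, of "[x, y]"] that by simp
    qed
  qed (auto simp: numeral_2_eq_2 length_Suc_conv)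
  then show ?thesis
    using assms tournament_code_structures[OF assms(1)] tournament_code_structures[OF assms(2)]
    unfolding structure_isomorphism_iff
    by (cases T; cases T') (simp add: tournament_code_def tournament_isomorphism_def digraph_iso_def)
qed

lemma continuous_tournament_code: "continuous_on UNIV tournament_code"
proof -
  have [continuous_intros]: "continuous_on UNIV
      (\<lambda>T :: (nat \<Rightarrow> bool) \<times> (nat \<Rightarrow> nat \<Rightarrow> bool). snd T x y)" for x y
    by (rule continuous_on_product_then_coordinatewise[OF
          continuous_on_product_then_coordinatewise[OF continuous_on_snd[OF continuous_on_id]]])
  have "continuous_on UNIV (\<lambda>T :: (nat \<Rightarrow> bool) \<times> (nat \<Rightarrow> nat \<Rightarrow> bool).
      i = 0 \<and> length xs = 2 \<and> snd T (xs ! 0) (xs ! 1))" for i :: nat and xs :: "nat list"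
    \<comment> \<open>Each coordinate is either constantly false or a coordinate of
      \<open>T\<close>.\<close>
    by (cases "i = 0 \<and> length xs = 2") (auto intro: continuous_intros)
  then show ?thesis
    unfolding tournament_code_def
    by (intro continuous_on_Pair continuous_on_fst continuous_on_id
        continuous_on_coordinatewise_then_product)
qed

theorem theorem4p5:
  fixes n :: enat and E :: "nat \<Rightarrow> nat \<Rightarrow> bool"
  assumes "2 \<le> n" and "generic_multipartite n E"
  shows "borel_reducible countable_tournaments tournament_isomorphism (Aut E) (conjugacy E)
       \<and> borel_complete (Aut E) (conjugacy E)"
proof -
  obtain f where f: "f \<in> borel_measurable borel" "\<And>M. f M \<in> Aut E"
    "\<And>L ar M M'. M \<in> structures L ar \<Longrightarrow> M' \<in> structures L ar \<Longrightarrow>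
      (f M, f M') \<in> conjugacy E \<longleftrightarrow> (M, M') \<in> structure_isomorphism L ar"
    using structures_reduction[OF assms] by metis
  \<comment> \<open>A Borel map on the whole space with all values in \<open>Aut E\<close> restricts
    to any domain.\<close>
  have restrict: "h \<in> restrict_space borel X \<rightarrow>\<^sub>M restrict_space borel (Aut E)"
    if "h \<in> borel_measurable borel" "\<And>x. h x \<in> Aut E" for h :: "'a::topological_space \<Rightarrow> _" and X
    using that by (intro measurable_restrict_space2 measurable_restrict_space1) auto
  have "borel_reducible countable_tournaments tournament_isomorphism (Aut E) (conjugacy E)"
    unfolding borel_reducible_def
  proof (intro bexI ballI)
    have "tournament_code \<in> borel_measurable borel"
      by (rule borel_measurable_continuous_onI[OF continuous_tournament_code])
    then have "f \<circ> tournament_code \<in> borel_measurable borel"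
      using f(1) by (rule measurable_comp)
    then show "f \<circ> tournament_code \<in>
        restrict_space borel countable_tournaments \<rightarrow>\<^sub>M restrict_space borel (Aut E)"
      by (rule restrict) (simp add: f(2))
    show "(T, T') \<in> tournament_isomorphism \<longleftrightarrow>
        ((f \<circ> tournament_code) T, (f \<circ> tournament_code) T') \<in> conjugacy E"
      if "T \<in> countable_tournaments" "T' \<in> countable_tournaments" for T T'
      using f(3)[OF tournament_code_structures[OF that(1)] tournament_code_structures[OF that(2)]]
        tournament_code_isomorphism[OF that] by simp
  qed
  moreover have "borel_reducible C (structure_isomorphism L ar) (Aut E) (conjugacy E)"
    if "C \<subseteq> structures L ar" for C L ar
    unfolding borel_reducible_def
  proof (intro bexI ballI)
    show "f \<in> restrict_space borel C \<rightarrow>\<^sub>M restrict_space borel (Aut E)"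
      using f(1,2) by (rule restrict)
    show "(M, M') \<in> structure_isomorphism L ar \<longleftrightarrow> (f M, f M') \<in> conjugacy E"
      if "M \<in> C" "M' \<in> C" for M M'
      using f(3)[of M L ar M'] that \<open>C \<subseteq> structures L ar\<close> by blast
  qed
  ultimately show ?thesis unfolding borel_complete_def by blast
qed

end
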